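(* Let $b,\sigma:[0,T]\times\mathbb R^2\to\mathbb R$ and $\mu,\rho:[0,T]\times\mathbb R\to\mathbb R$ be given coefficients (with $\rho$ nonvanishing). Let $u_0,u_1$ be functions of $(t,x)$ and $h$ a function of $(t,v)$, all sufficiently smooth, and set $$A(t,x)=\int_0^x\frac{u_0(t,y)}{\rho(t,y)}dy,\qquad B(t,x)=\int_0^x\frac{u_1(t,y)}{\rho(t,y)}dy,$$ with the normalization $h(0,v_0)+A(0,x_0)+B(0,x_0)v_0=0$. Then there is a positive function $\varphi$ with $h(t,v)=\ln\varphi(t,v,0)$ that solves $$\partial_t\varphi+b(t,v,x)\partial_v\varphi+\mu(t,x)\partial_x\varphi+\tfrac12\sigma^2(t,v,x)\partial_{vv}\varphi+\tfrac12\rho^2(t,x)\partial_{xx}\varphi=0\ \ \text{on }[0,T)\times\mathbb R^2,\qquad \varphi(0,v_0,x_0)=1,$$ and for which $u(t,v,x)=\rho(t,x)\,\partial_x\ln\varphi(t,v,x)$ has the affine structure $$u(t,v,x)=u_0(t,x)+u_1(t,x)v,\qquad (t,v,x)\in[0,T)\times\mathbb R^2,$$ if and only if the coefficients $b,\sigma,\mu,\rho$ satisfy the compatibility condition $$I_2(t,x)v^2+I_1(t,x)v+I_0(t,x)+G(t,v,x)=0,\qquad (t,v,x)\in[0,T)\times\mathbb R^2,$$ where $$I_0=A_t+\mu A_x+\tfrac12\rho^2[A_{xx}+A_x^2],\quad I_1=B_t+\mu B_x+\tfrac12\rho^2[B_{xx}+A_xB_x],\quad I_2=\tfrac12\rho^2B_x^2,$$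 $$G(t,v,x)=h_t(t,v)+b(t,v,x)[h_v(t,v)+B(t,x)]+\tfrac12\sigma^2(t,v,x)\{h_{vv}(t,v)+[h_v(t,v)+B(t,x)]^2\}.$$ Furthermore, in that case it holds that $\partial_{vvv}G(t,v,x)\equiv0$.
   Context: Subscripts denote partial derivatives. $(v_0,x_0)\in\mathbb R^2$ is the fixed initial point of the state process $(V,X)$. A function $u(t,v,x)$ is said to have an affine structure if $u(t,v,x)=u_0(t,x)+u_1(t,x)v$ for some functions $u_0,u_1$.
   Formalization: In I_1 the term A_xB_x is corrected to 2A_xB_x; as printed the equivalence fails, e.g. for ρ=u_0=u_1=1, μ=-1/2, b=σ=0, h=-tv²/2, v_0=x_0=0, where the printed condition holds but no φ exists. *)

theory Defs
  imports "HOL-Analysis.Analysis"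
begin

text \<open>
  Time derivatives are taken within \<open>[0,T)\<close>: they are one-sided at \<open>t = 0\<close> and
  ordinary derivatives for \<open>0 < t < T\<close>. Both \<^const>\<open>vector_derivative\<close> and
  \<^const>\<open>deriv\<close> are total, so existence of the derivatives is always required separately.
\<close>

definition dt :: "real \<Rightarrow> (real \<Rightarrow> real) \<Rightarrow> real \<Rightarrow> real" where
  "dt T f t = vector_derivative f (at t within {0..<T})"

text \<open>Jointly \<open>C\<^sup>1\<close> on \<open>[0,T) \<times> \<real>\<close>.\<close>

definition C1_fun :: "real \<Rightarrow> (real \<Rightarrow> real \<Rightarrow> real) \<Rightarrow> bool" where
  "C1_fun T f \<longleftrightarrow>
     (\<forall>t\<in>{0..<T}. \<forall>x. (\<lambda>s. f s x) differentiable (at t within {0..<T}) \<and>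
                        f t differentiable (at x)) \<and>
     continuous_on ({0..<T} \<times> UNIV) (\<lambda>(t, x). f t x) \<and>
     continuous_on ({0..<T} \<times> UNIV) (\<lambda>(t, x). dt T (\<lambda>s. f s x) t) \<and>
     continuous_on ({0..<T} \<times> UNIV) (\<lambda>(t, x). deriv (f t) x)"

text \<open>\<open>C\<^sup>1\<close> in time and \<open>C\<^sup>2\<close> in space on \<open>[0,T) \<times> \<real>\<close>.\<close>

definition C12_fun :: "real \<Rightarrow> (real \<Rightarrow> real \<Rightarrow> real) \<Rightarrow> bool" where
  "C12_fun T f \<longleftrightarrow> C1_fun T f \<and>
     (\<forall>t\<in>{0..<T}. \<forall>x. deriv (f t) differentiable (at x)) \<and>
     continuous_on ({0..<T} \<times> UNIV) (\<lambda>(t, x). deriv (deriv (f t)) x)"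

text \<open>
  Functions of three variables are written with arguments in the order \<open>t v x\<close>. A classical
  solution on \<open>[0,T) \<times> \<real>\<^sup>2\<close> is continuous, all derivatives occurring in the equation exist
  and are jointly continuous, and the equation holds pointwise.
\<close>

definition classical_solution ::
  "real \<Rightarrow> (real \<Rightarrow> real \<Rightarrow> real \<Rightarrow> real) \<Rightarrow> (real \<Rightarrow> real \<Rightarrow> real \<Rightarrow> real) \<Rightarrow>
   (real \<Rightarrow> real \<Rightarrow> real) \<Rightarrow> (real \<Rightarrow> real \<Rightarrow> real) \<Rightarrow>
   (real \<Rightarrow> real \<Rightarrow> real \<Rightarrow> real) \<Rightarrow> bool" where
  "classical_solution T b \<sigma> \<mu> \<rho> \<phi> \<longleftrightarrow>
     (\<forall>t\<in>{0..<T}. \<forall>v x.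
        (\<lambda>s. \<phi> s v x) differentiable (at t within {0..<T}) \<and>
        (\<lambda>w. \<phi> t w x) differentiable (at v) \<and>
        deriv (\<lambda>w. \<phi> t w x) differentiable (at v) \<and>
        (\<lambda>y. \<phi> t v y) differentiable (at x) \<and>
        deriv (\<lambda>y. \<phi> t v y) differentiable (at x)) \<and>
     continuous_on ({0..<T} \<times> UNIV) (\<lambda>(t, v, x). \<phi> t v x) \<and>
     continuous_on ({0..<T} \<times> UNIV) (\<lambda>(t, v, x). dt T (\<lambda>s. \<phi> s v x) t) \<and>
     continuous_on ({0..<T} \<times> UNIV) (\<lambda>(t, v, x). deriv (\<lambda>w. \<phi> t w x) v) \<and>
     continuous_on ({0..<T} \<times> UNIV) (\<lambda>(t, v, x). deriv (deriv (\<lambda>w. \<phi> t w x)) v) \<and>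
     continuous_on ({0..<T} \<times> UNIV) (\<lambda>(t, v, x). deriv (\<lambda>y. \<phi> t v y) x) \<and>
     continuous_on ({0..<T} \<times> UNIV) (\<lambda>(t, v, x). deriv (deriv (\<lambda>y. \<phi> t v y)) x) \<and>
     (\<forall>t\<in>{0..<T}. \<forall>v x.
        dt T (\<lambda>s. \<phi> s v x) t
        + b t v x * deriv (\<lambda>w. \<phi> t w x) v
        + \<mu> t x * deriv (\<lambda>y. \<phi> t v y) x
        + 1/2 * (\<sigma> t v x)\<^sup>2 * deriv (deriv (\<lambda>w. \<phi> t w x)) v
        + 1/2 * (\<rho> t x)\<^sup>2 * deriv (deriv (\<lambda>y. \<phi> t v y)) x = 0)"

definition I0 ::
  "real \<Rightarrow> (real \<Rightarrow> real \<Rightarrow> real) \<Rightarrow> (real \<Rightarrow> real \<Rightarrow> real) \<Rightarrow> (real \<Rightarrow> real \<Rightarrow> real) \<Rightarrow>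
   real \<Rightarrow> real \<Rightarrow> real" where
  "I0 T \<mu> \<rho> A t x =
     dt T (\<lambda>s. A s x) t + \<mu> t x * deriv (A t) x
     + 1/2 * (\<rho> t x)\<^sup>2 * (deriv (deriv (A t)) x + (deriv (A t) x)\<^sup>2)"

text \<open>
  The factor 2 is the one in the cross term of \<open>(A\<^sub>x + B\<^sub>x v)\<^sup>2\<close>. Without it (as in the source,
  by a misprint) the equivalence fails: for \<open>\<rho> = u\<^sub>0 = u\<^sub>1 = 1\<close>, \<open>\<mu> = -1/2\<close>, \<open>b = \<sigma> = 0\<close>,
  \<open>h(t,v) = -t v\<^sup>2/2\<close> and \<open>v\<^sub>0 = x\<^sub>0 = 0\<close> the misprinted condition holds, but the only
  candidate \<open>\<phi> = exp (h + A + B v)\<close> leaves the residual \<open>\<phi> v/2\<close> in the equation.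
\<close>

definition I1 ::
  "real \<Rightarrow> (real \<Rightarrow> real \<Rightarrow> real) \<Rightarrow> (real \<Rightarrow> real \<Rightarrow> real) \<Rightarrow> (real \<Rightarrow> real \<Rightarrow> real) \<Rightarrow>
   (real \<Rightarrow> real \<Rightarrow> real) \<Rightarrow> real \<Rightarrow> real \<Rightarrow> real" where
  "I1 T \<mu> \<rho> A B t x =
     dt T (\<lambda>s. B s x) t + \<mu> t x * deriv (B t) x
     + 1/2 * (\<rho> t x)\<^sup>2 * (deriv (deriv (B t)) x + 2 * deriv (A t) x * deriv (B t) x)"

definition I2 ::
  "(real \<Rightarrow> real \<Rightarrow> real) \<Rightarrow> (real \<Rightarrow> real \<Rightarrow> real) \<Rightarrow> real \<Rightarrow> real \<Rightarrow> real" where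
  "I2 \<rho> B t x = 1/2 * (\<rho> t x)\<^sup>2 * (deriv (B t) x)\<^sup>2"

definition G ::
  "real \<Rightarrow> (real \<Rightarrow> real \<Rightarrow> real \<Rightarrow> real) \<Rightarrow> (real \<Rightarrow> real \<Rightarrow> real \<Rightarrow> real) \<Rightarrow>
   (real \<Rightarrow> real \<Rightarrow> real) \<Rightarrow> (real \<Rightarrow> real \<Rightarrow> real) \<Rightarrow> real \<Rightarrow> real \<Rightarrow> real \<Rightarrow> real" where
  "G T b \<sigma> h B t v x =
     dt T (\<lambda>s. h s v) t + b t v x * (deriv (h t) v + B t x)
     + 1/2 * (\<sigma> t v x)\<^sup>2 * (deriv (deriv (h t)) v + (deriv (h t) v + B t x)\<^sup>2)"

definition compatibility ::
  "real \<Rightarrow> (real \<Rightarrow> real \<Rightarrow> real \<Rightarrow> real) \<Rightarrow> (real \<Rightarrow> real \<Rightarrow> real \<Rightarrow> real) \<Rightarrow>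
   (real \<Rightarrow> real \<Rightarrow> real) \<Rightarrow> (real \<Rightarrow> real \<Rightarrow> real) \<Rightarrow>
   (real \<Rightarrow> real \<Rightarrow> real) \<Rightarrow> (real \<Rightarrow> real \<Rightarrow> real) \<Rightarrow> (real \<Rightarrow> real \<Rightarrow> real) \<Rightarrow> bool" where
  "compatibility T b \<sigma> \<mu> \<rho> h A B \<longleftrightarrow>
     (\<forall>t\<in>{0..<T}. \<forall>v x.
        I2 \<rho> B t x * v\<^sup>2 + I1 T \<mu> \<rho> A B t x * v + I0 T \<mu> \<rho> A t x + G T b \<sigma> h B t v x = 0)"

end

theory Submission imports Defs begin

text \<open>
  The affine structure of \<open>u\<close> prescribes the \<open>x\<close>-derivative of \<open>ln \<phi>\<close>, namely
  \<open>u\<^sub>0/\<rho> + v u\<^sub>1/\<rho>\<close>, while \<open>h\<close> prescribes \<open>ln \<phi>\<close> on the line \<open>x = 0\<close>. Integrating in \<open>x\<close> leaves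
  exactly one candidate on \<open>[0,T)\<close>,
  \<open>\<Phi>(t,v,x) = exp (h(t,v) + A(t,x) + B(t,x) v)\<close>
  (lemma \<open>eq_exp_of_log_derivative\<close>), and the normalization is \<open>\<Phi>(0,v\<^sub>0,x\<^sub>0) = 1\<close>. Everything
  therefore reduces to the question when \<open>\<Phi>\<close> solves the equation. Each derivative of an exponential
  is that exponential times a polynomial in derivatives of the exponent, so the left side of the
  equation at \<open>\<Phi>\<close> is \<open>\<Phi>\<close> times an expression that, sorted by the explicit powers of \<open>v\<close>, reads
  \<open>I\<^sub>2 v\<^sup>2 + I\<^sub>1 v + I\<^sub>0 + G\<close>; as \<open>\<Phi> > 0\<close>, it vanishes exactly under the compatibility condition
  (lemma \<open>classical_solution_exp_affine_iff\<close>). Under that condition \<open>G\<close> is, as a function of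
  \<open>v\<close>, a polynomial of degree at most two, and its third derivative is zero.

  The analytic content is the regularity of \<open>A\<close> and \<open>B\<close>, which are primitives with a moving
  endpoint and a parameter \<open>t\<close> (lemma \<open>C12_fun_primitive\<close>). The substitution \<open>y = x s\<close> turns them
  into \<open>x\<close> times an integral over the fixed interval \<open>[0,1]\<close>, to which continuity of parameter
  integrals and the Leibniz rule apply.
\<close>

section \<open>One-sided time derivatives and joint continuity\<close>

lemma dt_works:
  assumes "f differentiable (at t within {0..<T})"
  shows "(f has_real_derivative dt T f t) (at t within {0..<T})"
  using assms unfolding dt_def has_real_derivative_iff_has_vector_derivative
  by (simp add: vector_derivative_works)

lemma dt_eqI:
  assumes "t \<in> {0..<T}" "(f has_real_derivative D) (at t within {0..<T})"
  shows "dt T f t = D"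
proof -
  have "at t within {0..<T} \<noteq> bot"
    using assms(1) by (simp add: trivial_limit_within)
  then show ?thesis
    using assms(2) unfolding dt_def has_real_derivative_iff_has_vector_derivative
    by (rule vector_derivative_within)
qed

lemma dt_cong:
  assumes "t \<in> {0..<T}" "\<And>s. s \<in> {0..<T} \<Longrightarrow> f s = g s"
  shows "dt T f t = dt T g t"
  unfolding dt_def by (rule vector_derivative_cong_eq) (use assms in auto)

lemma deriv_works:
  fixes f :: "real \<Rightarrow> real"
  assumes "f differentiable (at x)"
  shows "(f has_real_derivative deriv f x) (at x)"
  using assms by (simp add: DERIV_deriv_iff_real_differentiable)

lemma continuous_on_constant_in_v:
  assumes "continuous_on (I \<times> UNIV) (\<lambda>(t, x). f t x)"
  shows "continuous_on (I \<times> UNIV) (\<lambda>(t, v, x). f t x)"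
proof -
  have "continuous_on (I \<times> UNIV) (\<lambda>p. (\<lambda>(t, x). f t x) (fst p, snd (snd p)))"
    by (rule continuous_on_compose2[OF assms]) (auto intro!: continuous_intros)
  then show ?thesis by (simp add: case_prod_unfold)
qed

lemma continuous_on_constant_in_x:
  assumes "continuous_on (I \<times> UNIV) (\<lambda>(t, v). f t v)"
  shows "continuous_on (I \<times> UNIV) (\<lambda>(t, v, x). f t v)"
proof -
  have "continuous_on (I \<times> UNIV) (\<lambda>p. (\<lambda>(t, v). f t v) (fst p, fst (snd p)))"
    by (rule continuous_on_compose2[OF assms]) (auto intro!: continuous_intros)
  then show ?thesis by (simp add: case_prod_unfold)
qed

section \<open>Primitives with a time parameter\<close>

lemma primitive_has_derivative:
  fixes f :: "real \<Rightarrow> real"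
  assumes "continuous_on UNIV f"
  shows "((\<lambda>u. LBINT y=0..u. f y) has_real_derivative f x) (at x)"
proof -
  \<comment> \<open>An interval that contains \<open>0\<close> and has \<open>x\<close> in its interior.\<close>
  let ?a = "- \<bar>x\<bar> - 1" and ?b = "\<bar>x\<bar> + 1"
  have "((\<lambda>u. LBINT y=ereal 0..u. f y) has_vector_derivative f x) (at x within {?a..?b})"
    by (rule interval_integral_FTC2) (use assms continuous_on_subset in auto)
  moreover have "at x within {?a..?b} = at x"
    by (rule at_within_interior) auto
  ultimately show ?thesis
    by (simp add: has_real_derivative_iff_has_vector_derivative zero_ereal_def)
qed

text \<open>
  This is the substitution \<open>y = x s\<close>. Its merit is an integration domain that does not depend on
  \<open>x\<close>, with no distinction according to the sign of \<open>x\<close>.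
\<close>

lemma primitive_rescaled:
  fixes f :: "real \<Rightarrow> real"
  assumes "continuous_on UNIV f"
  shows "(LBINT y=0..x. f y) = x * integral {0..1} (\<lambda>s. f (x * s))"
proof -
  let ?P = "\<lambda>u. LBINT y=0..u. f y"
  have "((\<lambda>s. x * f (x * s)) has_integral ?P (x * 1) - ?P (x * 0)) {0..1}"
  proof (rule fundamental_theorem_of_calculus)
    fix s :: real
    have "((\<lambda>s. ?P (x * s)) has_real_derivative f (x * s) * x) (at s within {0..1})"
      by (rule DERIV_chain2[OF primitive_has_derivative[OF assms]])
         (auto intro!: derivative_eq_intros)
    then show "((\<lambda>s. ?P (x * s)) has_vector_derivative x * f (x * s)) (at s within {0..1})"
      by (simp add: has_real_derivative_iff_has_vector_derivative mult.commute)
  qed simp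
  then have "integral {0..1} (\<lambda>s. x * f (x * s)) = ?P (x * 1) - ?P (x * 0)"
    by (rule integral_unique)
  then show ?thesis by (simp add: zero_ereal_def[symmetric])
qed

lemma continuous_on_slice:
  assumes "continuous_on (I \<times> UNIV) (\<lambda>(t, x). f t x)" "t \<in> I"
  shows "continuous_on UNIV (f t)"
proof -
  have "continuous_on UNIV (\<lambda>x. (\<lambda>(t, x). f t x) (t, x))"
    by (rule continuous_on_compose2[OF assms(1)]) (use assms(2) in \<open>auto intro!: continuous_intros\<close>)
  then show ?thesis by simp
qed

lemma continuous_on_rescaled_integral:
  fixes g :: "real \<Rightarrow> real \<Rightarrow> real"
  assumes "continuous_on (I \<times> UNIV) (\<lambda>(t, x). g t x)"
  shows "continuous_on (I \<times> UNIV) (\<lambda>(t, x). x * integral {0..1} (\<lambda>s. g t (x * s)))"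
proof -
  have "continuous_on ((I \<times> UNIV) \<times> cbox 0 1)
      (\<lambda>p. (\<lambda>(t, x). g t x) (fst (fst p), snd (fst p) * snd p))"
    by (rule continuous_on_compose2[OF assms]) (auto intro!: continuous_intros)
  then have "continuous_on (I \<times> UNIV) (\<lambda>p. integral (cbox 0 1) (\<lambda>s. g (fst p) (snd p * s)))"
    by (intro integral_continuous_on_param) (simp add: case_prod_unfold)
  then have "continuous_on (I \<times> UNIV) (\<lambda>p. snd p * integral (cbox 0 1) (\<lambda>s. g (fst p) (snd p * s)))"
    by (intro continuous_intros)
  then show ?thesis by (simp add: case_prod_unfold)
qed

text \<open>
  In space, the primitive gains one derivative over \<open>g\<close> by the fundamental theorem of calculus. In
  time, it inherits the derivative of \<open>g\<close> by differentiation under the integral sign, and the result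
  is again a rescaled integral, now of \<open>g\<^sub>t\<close>; this gives its joint continuity.
\<close>

lemma C12_fun_primitive:
  assumes g: "C1_fun T g"
    and F: "F = (\<lambda>t x. LBINT y=0..x. g t y)"
  shows "C12_fun T F" "\<And>t x. t \<in> {0..<T} \<Longrightarrow> deriv (F t) x = g t x"
proof -
  let ?I = "{0..<T}"
  have cg: "continuous_on (?I \<times> UNIV) (\<lambda>(t, x). g t x)"
   and cdt: "continuous_on (?I \<times> UNIV) (\<lambda>(t, x). dt T (\<lambda>s. g s x) t)"
   and cdx: "continuous_on (?I \<times> UNIV) (\<lambda>(t, x). deriv (g t) x)"
   and ddt: "\<And>t x. t \<in> ?I \<Longrightarrow> (\<lambda>s. g s x) differentiable (at t within ?I)"
   and ddx: "\<And>t x. t \<in> ?I \<Longrightarrow> g t differentiable (at x)"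
    using g by (auto simp: C1_fun_def)
  have gt: "continuous_on UNIV (g t)" if "t \<in> ?I" for t
    by (rule continuous_on_slice[OF cg that])
  have F_eq: "F t x = x * integral {0..1} (\<lambda>s. g t (x * s))" if "t \<in> ?I" for t x
    unfolding F by (rule primitive_rescaled[OF gt[OF that]])
  have Dx: "(F t has_real_derivative g t x) (at x)" if "t \<in> ?I" for t x
    using primitive_has_derivative[OF gt[OF that]] by (simp add: F)
  then show dF: "deriv (F t) x = g t x" if "t \<in> ?I" for t x
    using that by (blast intro: DERIV_imp_deriv)
  have dF': "deriv (F t) = g t" if "t \<in> ?I" for t
    using dF that by blast
  have Dt: "((\<lambda>s. F s x) has_real_derivative
      x * integral {0..1} (\<lambda>r. dt T (\<lambda>s. g s (x * r)) t)) (at t within ?I)"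
    if t: "t \<in> ?I" for t x
  proof -
    have "((\<lambda>s. integral (cbox 0 1) (\<lambda>r. g s (x * r))) has_real_derivative
        integral (cbox 0 1) (\<lambda>r. dt T (\<lambda>s. g s (x * r)) t)) (at t within ?I)"
    proof (rule leibniz_rule_field_derivative)
      show "((\<lambda>s. g s (x * r)) has_real_derivative dt T (\<lambda>s. g s (x * r)) t') (at t' within ?I)"
        if "t' \<in> ?I" for t' r
        by (rule dt_works[OF ddt[OF that]])
      show "(\<lambda>r. g t' (x * r)) integrable_on cbox 0 1" if "t' \<in> ?I" for t'
        by (intro integrable_continuous continuous_on_compose2[OF gt[OF that]])
           (auto intro!: continuous_intros)
      have "continuous_on (?I \<times> cbox 0 1)
          (\<lambda>p. (\<lambda>(t, x). dt T (\<lambda>s. g s x) t) (fst p, x * snd p))"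
        by (rule continuous_on_compose2[OF cdt]) (auto intro!: continuous_intros)
      then show "continuous_on (?I \<times> cbox 0 1) (\<lambda>(t, r). dt T (\<lambda>s. g s (x * r)) t)"
        by (simp add: case_prod_unfold)
    qed (use t in auto)
    then have "((\<lambda>s. x * integral {0..1} (\<lambda>r. g s (x * r))) has_real_derivative
        x * integral {0..1} (\<lambda>r. dt T (\<lambda>s. g s (x * r)) t)) (at t within ?I)"
      by (intro DERIV_cmult) simp
    then show ?thesis
      by (rule has_field_derivative_transform_within[OF _ zero_less_one t]) (simp add: F_eq)
  qed
  have dtF: "dt T (\<lambda>s. F s x) t = x * integral {0..1} (\<lambda>r. dt T (\<lambda>s. g s (x * r)) t)"
    if "t \<in> ?I" for t x
    by (rule dt_eqI[OF that Dt[OF that]])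
  have cF: "continuous_on (?I \<times> UNIV) (\<lambda>(t, x). F t x)"
    using continuous_on_rescaled_integral[OF cg]
    by (rule continuous_on_eq) (auto simp: F_eq)
  have cFt: "continuous_on (?I \<times> UNIV) (\<lambda>(t, x). dt T (\<lambda>s. F s x) t)"
    using continuous_on_rescaled_integral[OF cdt]
    by (rule continuous_on_eq) (auto simp: dtF)
  have cFx: "continuous_on (?I \<times> UNIV) (\<lambda>(t, x). deriv (F t) x)"
    using cg by (rule continuous_on_eq) (auto simp: dF)
  have cFxx: "continuous_on (?I \<times> UNIV) (\<lambda>(t, x). deriv (deriv (F t)) x)"
    using cdx by (rule continuous_on_eq) (auto simp: dF')
  have "(\<lambda>s. F s x) differentiable (at t within ?I)" "F t differentiable (at x)"
    "deriv (F t) differentiable (at x)" if "t \<in> ?I" for t x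
    using Dt[OF that] Dx[OF that] ddx[OF that] unfolding real_differentiable_def dF'[OF that]
    by blast+
  then show "C12_fun T F"
    unfolding C12_fun_def C1_fun_def
    using cF cFt cFx cFxx by blast
qed

section \<open>The exponential ansatz\<close>

text \<open>
  Regularity of \<open>\<Phi>\<close> is automatic, so only the equation itself is at stake, and there \<open>\<Phi>\<close> factors
  out. The three terms from \<open>(A\<^sub>x + B\<^sub>x v)\<^sup>2\<close> are distributed over \<open>I\<^sub>0\<close>, \<open>I\<^sub>1\<close> and \<open>I\<^sub>2\<close>; the
  \<open>v\<close>-derivatives of \<open>\<Phi>\<close> and the time derivative of \<open>h\<close> form \<open>G\<close>.
\<close>

lemma classical_solution_exp_affine_iff:
  fixes \<Phi> :: "real \<Rightarrow> real \<Rightarrow> real \<Rightarrow> real"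
  assumes h: "C12_fun T h" and A: "C12_fun T A" and B: "C12_fun T B"
    and \<Phi>: "\<Phi> = (\<lambda>t v x. exp (h t v + A t x + B t x * v))"
  shows "classical_solution T b \<sigma> \<mu> \<rho> \<Phi> \<longleftrightarrow> compatibility T b \<sigma> \<mu> \<rho> h A B"
proof -
  let ?I = "{0..<T}"
  note C = C12_fun_def C1_fun_def
  have ht: "((\<lambda>s. h s v) has_real_derivative dt T (\<lambda>s. h s v) t) (at t within ?I)"
   and At: "((\<lambda>s. A s x) has_real_derivative dt T (\<lambda>s. A s x) t) (at t within ?I)"
   and Bt: "((\<lambda>s. B s x) has_real_derivative dt T (\<lambda>s. B s x) t) (at t within ?I)"
   and hv: "(h t has_real_derivative deriv (h t) v) (at v)"
   and Ax: "(A t has_real_derivative deriv (A t) x) (at x)"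
   and Bx: "(B t has_real_derivative deriv (B t) x) (at x)"
   and hvv: "(deriv (h t) has_real_derivative deriv (deriv (h t)) v) (at v)"
   and Axx: "(deriv (A t) has_real_derivative deriv (deriv (A t)) x) (at x)"
   and Bxx: "(deriv (B t) has_real_derivative deriv (deriv (B t)) x) (at x)"
    if "t \<in> ?I" for t v x
    using h A B that by (auto simp: C intro!: dt_works deriv_works)
  have Dt: "((\<lambda>s. \<Phi> s v x) has_real_derivative
      \<Phi> t v x * (dt T (\<lambda>s. h s v) t + dt T (\<lambda>s. A s x) t + dt T (\<lambda>s. B s x) t * v)) (at t within ?I)"
    if "t \<in> ?I" for t v x
    unfolding \<Phi> using that
    by (auto intro!: derivative_eq_intros ht At Bt)
  have Dv: "((\<lambda>w. \<Phi> t w x) has_real_derivative \<Phi> t v x * (deriv (h t) v + B t x)) (at v)"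
    if "t \<in> ?I" for t v x
    unfolding \<Phi> using that by (auto intro!: derivative_eq_intros hv)
  have Dx: "((\<lambda>y. \<Phi> t v y) has_real_derivative
      \<Phi> t v x * (deriv (A t) x + deriv (B t) x * v)) (at x)"
    if "t \<in> ?I" for t v x
    unfolding \<Phi> using that by (auto intro!: derivative_eq_intros Ax Bx)
  have dt\<Phi>: "dt T (\<lambda>s. \<Phi> s v x) t =
      \<Phi> t v x * (dt T (\<lambda>s. h s v) t + dt T (\<lambda>s. A s x) t + dt T (\<lambda>s. B s x) t * v)"
    if "t \<in> ?I" for t v x
    by (rule dt_eqI[OF that Dt[OF that]])
  have dv\<Phi>: "deriv (\<lambda>w. \<Phi> t w x) = (\<lambda>v. \<Phi> t v x * (deriv (h t) v + B t x))"
    if "t \<in> ?I" for t x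
    using Dv[OF that] by (blast intro: DERIV_imp_deriv)
  have dx\<Phi>: "deriv (\<lambda>y. \<Phi> t v y) = (\<lambda>x. \<Phi> t v x * (deriv (A t) x + deriv (B t) x * v))"
    if "t \<in> ?I" for t v
    using Dx[OF that] by (blast intro: DERIV_imp_deriv)
  have Dvv: "(deriv (\<lambda>w. \<Phi> t w x) has_real_derivative
      \<Phi> t v x * (deriv (deriv (h t)) v + (deriv (h t) v + B t x)\<^sup>2)) (at v)"
    if "t \<in> ?I" for t v x
    unfolding dv\<Phi>[OF that]
    by (auto intro!: derivative_eq_intros Dv hvv that simp: algebra_simps power2_eq_square)
  have Dxx: "(deriv (\<lambda>y. \<Phi> t v y) has_real_derivative
      \<Phi> t v x * (deriv (deriv (A t)) x + deriv (deriv (B t)) x * v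
        + (deriv (A t) x + deriv (B t) x * v)\<^sup>2)) (at x)"
    if "t \<in> ?I" for t v x
    unfolding dx\<Phi>[OF that]
    by (auto intro!: derivative_eq_intros Dx Axx Bxx that simp: algebra_simps power2_eq_square)
  have dvv\<Phi>: "deriv (deriv (\<lambda>w. \<Phi> t w x)) v =
      \<Phi> t v x * (deriv (deriv (h t)) v + (deriv (h t) v + B t x)\<^sup>2)"
    and dxx\<Phi>: "deriv (deriv (\<lambda>y. \<Phi> t v y)) x =
      \<Phi> t v x * (deriv (deriv (A t)) x + deriv (deriv (B t)) x * v
        + (deriv (A t) x + deriv (B t) x * v)\<^sup>2)"
    if "t \<in> ?I" for t v x
    using Dvv[OF that] Dxx[OF that] by (blast intro: DERIV_imp_deriv)+
  have ch: "continuous_on (?I \<times> UNIV) (\<lambda>(t, v, x::real). h t v)"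
      "continuous_on (?I \<times> UNIV) (\<lambda>(t, v, x::real). dt T (\<lambda>s. h s v) t)"
      "continuous_on (?I \<times> UNIV) (\<lambda>(t, v, x::real). deriv (h t) v)"
      "continuous_on (?I \<times> UNIV) (\<lambda>(t, v, x::real). deriv (deriv (h t)) v)"
    using h by (auto simp: C intro!: continuous_on_constant_in_x)
  have cF: "continuous_on (?I \<times> UNIV) (\<lambda>(t, v::real, x). F t x)"
      "continuous_on (?I \<times> UNIV) (\<lambda>(t, v::real, x). dt T (\<lambda>s. F s x) t)"
      "continuous_on (?I \<times> UNIV) (\<lambda>(t, v::real, x). deriv (F t) x)"
      "continuous_on (?I \<times> UNIV) (\<lambda>(t, v::real, x). deriv (deriv (F t)) x)"
    if "C12_fun T F" for F
    using that by (auto simp: C intro!: continuous_on_constant_in_v)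
  note cont = ch[unfolded case_prod_unfold] cF[OF A, unfolded case_prod_unfold]
    cF[OF B, unfolded case_prod_unfold]
  have c\<Phi>: "continuous_on (?I \<times> UNIV) (\<lambda>p. \<Phi> (fst p) (fst (snd p)) (snd (snd p)))"
    unfolding \<Phi> by (intro continuous_intros cont)
  have regular:
    "continuous_on (?I \<times> UNIV) (\<lambda>(t, v, x). dt T (\<lambda>s. \<Phi> s v x) t)"
    "continuous_on (?I \<times> UNIV) (\<lambda>(t, v, x). deriv (\<lambda>w. \<Phi> t w x) v)"
    "continuous_on (?I \<times> UNIV) (\<lambda>(t, v, x). deriv (deriv (\<lambda>w. \<Phi> t w x)) v)"
    "continuous_on (?I \<times> UNIV) (\<lambda>(t, v, x). deriv (\<lambda>y. \<Phi> t v y) x)"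
    "continuous_on (?I \<times> UNIV) (\<lambda>(t, v, x). deriv (deriv (\<lambda>y. \<Phi> t v y)) x)"
    subgoal
      by (rule continuous_on_eq[of _ "\<lambda>(t, v, x). \<Phi> t v x *
          (dt T (\<lambda>s. h s v) t + dt T (\<lambda>s. A s x) t + dt T (\<lambda>s. B s x) t * v)"])
         (auto simp: dt\<Phi> case_prod_unfold intro!: continuous_intros c\<Phi> cont)
    subgoal
      by (rule continuous_on_eq[of _ "\<lambda>(t, v, x). \<Phi> t v x * (deriv (h t) v + B t x)"])
         (auto simp: dv\<Phi> case_prod_unfold intro!: continuous_intros c\<Phi> cont)
    subgoal
      by (rule continuous_on_eq[of _ "\<lambda>(t, v, x).
          \<Phi> t v x * (deriv (deriv (h t)) v + (deriv (h t) v + B t x)\<^sup>2)"])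
         (auto simp: dvv\<Phi> case_prod_unfold intro!: continuous_intros c\<Phi> cont)
    subgoal
      by (rule continuous_on_eq[of _ "\<lambda>(t, v, x).
          \<Phi> t v x * (deriv (A t) x + deriv (B t) x * v)"])
         (auto simp: dx\<Phi> case_prod_unfold intro!: continuous_intros c\<Phi> cont)
    subgoal
      by (rule continuous_on_eq[of _ "\<lambda>(t, v, x).
          \<Phi> t v x * (deriv (deriv (A t)) x + deriv (deriv (B t)) x * v
            + (deriv (A t) x + deriv (B t) x * v)\<^sup>2)"])
         (auto simp: dxx\<Phi> case_prod_unfold intro!: continuous_intros c\<Phi> cont)
    done
  have nz: "\<Phi> t v x \<noteq> 0" for t v x
    by (simp add: \<Phi>)
  let ?L = "\<lambda>t v x. dt T (\<lambda>s. \<Phi> s v x) t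
        + b t v x * deriv (\<lambda>w. \<Phi> t w x) v
        + \<mu> t x * deriv (\<lambda>y. \<Phi> t v y) x
        + 1/2 * (\<sigma> t v x)\<^sup>2 * deriv (deriv (\<lambda>w. \<Phi> t w x)) v
        + 1/2 * (\<rho> t x)\<^sup>2 * deriv (deriv (\<lambda>y. \<Phi> t v y)) x"
  have residual: "?L t v x =
      \<Phi> t v x * (I2 \<rho> B t x * v\<^sup>2 + I1 T \<mu> \<rho> A B t x * v + I0 T \<mu> \<rho> A t x
          + G T b \<sigma> h B t v x)" if "t \<in> ?I" for t v x
    \<comment> \<open>Second derivatives come first: unfolding a first derivative inside them would block their rules.\<close>
    unfolding dvv\<Phi>[OF that] dxx\<Phi>[OF that]
    unfolding dt\<Phi>[OF that] dv\<Phi>[OF that] dx\<Phi>[OF that]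
      I0_def I1_def I2_def G_def
    by (simp add: field_simps power2_eq_square)
  have equation_iff: "(\<forall>t\<in>?I. \<forall>v x. ?L t v x = 0) \<longleftrightarrow> compatibility T b \<sigma> \<mu> \<rho> h A B"
    unfolding compatibility_def
    by (intro ball_cong refl iff_allI) (simp only: residual mult_eq_0_iff nz simp_thms)
  have diff: "(\<lambda>s. \<Phi> s v x) differentiable (at t within ?I)"
    "(\<lambda>w. \<Phi> t w x) differentiable (at v)"
    "deriv (\<lambda>w. \<Phi> t w x) differentiable (at v)"
    "(\<lambda>y. \<Phi> t v y) differentiable (at x)"
    "deriv (\<lambda>y. \<Phi> t v y) differentiable (at x)" if "t \<in> ?I" for t v x
    using Dt[OF that] Dv[OF that] Dx[OF that] Dvv[OF that] Dxx[OF that]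
    unfolding real_differentiable_def by blast+
  have c\<Phi>': "continuous_on (?I \<times> UNIV) (\<lambda>(t, v, x). \<Phi> t v x)"
    using c\<Phi> by (simp add: case_prod_unfold)
  show ?thesis
    unfolding classical_solution_def equation_iff
    using diff c\<Phi>' regular by blast
qed

text \<open>
  Outside \<open>[0,T)\<close> nothing constrains \<open>\<phi>\<close>, so a solution agrees with the candidate
  on \<open>[0,T)\<close> only. This is enough because time derivatives are taken within that interval.
\<close>

lemma classical_solution_cong:
  assumes eq: "\<And>t v x. t \<in> {0..<T} \<Longrightarrow> \<phi> t v x = \<psi> t v x"
    and sol: "classical_solution T b \<sigma> \<mu> \<rho> \<phi>"
  shows "classical_solution T b \<sigma> \<mu> \<rho> \<psi>"
proof -
  have sp: "\<phi> t = \<psi> t" if "t \<in> {0..<T}" for t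
    using eq that by blast
  have tm: "dt T (\<lambda>s. \<phi> s v x) t = dt T (\<lambda>s. \<psi> s v x) t" if "t \<in> {0..<T}" for t v x
    by (rule dt_cong[OF that eq])
  have td: "(\<lambda>s. \<psi> s v x) differentiable (at t within {0..<T})"
    if "t \<in> {0..<T}" "(\<lambda>s. \<phi> s v x) differentiable (at t within {0..<T})" for t v x
    by (rule differentiable_transform_within[OF that(2) zero_less_one that(1)]) (simp add: eq)
  have cc: "continuous_on ({0..<T} \<times> UNIV) f \<longleftrightarrow> continuous_on ({0..<T} \<times> UNIV) g"
    if "\<And>t v x. t \<in> {0..<T} \<Longrightarrow> f (t, v, x) = g (t, v, x)"
    for f g :: "real \<times> real \<times> real \<Rightarrow> real"
    by (rule continuous_on_cong) (use that in auto)
  have c: "continuous_on ({0..<T} \<times> UNIV) (\<lambda>(t, v, x). \<phi> t v x)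
        \<longleftrightarrow> continuous_on ({0..<T} \<times> UNIV) (\<lambda>(t, v, x). \<psi> t v x)"
     "continuous_on ({0..<T} \<times> UNIV) (\<lambda>(t, v, x). dt T (\<lambda>s. \<phi> s v x) t)
        \<longleftrightarrow> continuous_on ({0..<T} \<times> UNIV) (\<lambda>(t, v, x). dt T (\<lambda>s. \<psi> s v x) t)"
     "continuous_on ({0..<T} \<times> UNIV) (\<lambda>(t, v, x). deriv (\<lambda>w. \<phi> t w x) v)
        \<longleftrightarrow> continuous_on ({0..<T} \<times> UNIV) (\<lambda>(t, v, x). deriv (\<lambda>w. \<psi> t w x) v)"
     "continuous_on ({0..<T} \<times> UNIV) (\<lambda>(t, v, x). deriv (deriv (\<lambda>w. \<phi> t w x)) v)
        \<longleftrightarrow> continuous_on ({0..<T} \<times> UNIV) (\<lambda>(t, v, x). deriv (deriv (\<lambda>w. \<psi> t w x)) v)"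
     "continuous_on ({0..<T} \<times> UNIV) (\<lambda>(t, v, x). deriv (\<lambda>y. \<phi> t v y) x)
        \<longleftrightarrow> continuous_on ({0..<T} \<times> UNIV) (\<lambda>(t, v, x). deriv (\<lambda>y. \<psi> t v y) x)"
     "continuous_on ({0..<T} \<times> UNIV) (\<lambda>(t, v, x). deriv (deriv (\<lambda>y. \<phi> t v y)) x)
        \<longleftrightarrow> continuous_on ({0..<T} \<times> UNIV) (\<lambda>(t, v, x). deriv (deriv (\<lambda>y. \<psi> t v y)) x)"
    by (rule cc; simp add: sp tm)+
  show ?thesis
    using sol unfolding classical_solution_def c by (simp add: sp tm td)
qed

text \<open>The functions \<open>ln \<circ> p\<close> and \<open>P\<close> have the same derivative, so \<open>ln \<circ> p - P\<close> is constant.\<close>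

lemma eq_exp_of_log_derivative:
  fixes p P :: "real \<Rightarrow> real"
  assumes pos: "\<And>x. p x > 0" and diff: "\<And>x. p differentiable (at x)"
    and P: "\<And>x. (P has_real_derivative deriv (\<lambda>y. ln (p y)) x) (at x)" and "P 0 = 0"
  shows "p x = exp (ln (p 0) + P x)"
proof -
  have D: "((\<lambda>y. ln (p y)) has_real_derivative deriv (\<lambda>y. ln (p y)) x) (at x)" for x
  proof (rule deriv_works)
    show "(\<lambda>y. ln (p y)) differentiable (at x)"
      using DERIV_chain2[OF DERIV_ln_divide[OF pos] deriv_works[OF diff]]
      unfolding real_differentiable_def by (rule exI)
  qed
  have "((\<lambda>y. ln (p y) - P y) has_real_derivative 0) (at x)" for x
    using DERIV_diff[OF D P] by simp
  then have "ln (p x) - P x = ln (p 0) - P 0"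
    by (intro DERIV_isconst_all) blast
  then show ?thesis using pos[of x] \<open>P 0 = 0\<close> by (metis add.commute diff_eq_eq diff_zero exp_ln)
qed

section \<open>The equivalence\<close>

lemma quadratic_third_derivative:
  fixes f :: "real \<Rightarrow> real"
  assumes f: "\<And>w. f w = a * w\<^sup>2 + b * w + c"
  shows "(\<forall>k<3. (deriv ^^ k) f differentiable (at v)) \<and> (deriv ^^ 3) f v = 0"
proof -
  have 0: "(f has_real_derivative 2 * a * w + b) (at w)" for w
    unfolding f[abs_def] by (auto intro!: derivative_eq_intros)
  then have d1: "deriv f = (\<lambda>w. 2 * a * w + b)"
    by (blast intro: DERIV_imp_deriv)
  have 1: "((\<lambda>w. 2 * a * w + b) has_real_derivative 2 * a) (at w)" for w
    by (auto intro!: derivative_eq_intros)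
  then have d2: "deriv (\<lambda>w. 2 * a * w + b) = (\<lambda>w. 2 * a)"
    by (blast intro: DERIV_imp_deriv)
  have "f differentiable (at v)" "(\<lambda>w. 2 * a * w + b) differentiable (at v)"
    using 0 1 unfolding real_differentiable_def by blast+
  then show ?thesis
    by (auto simp: numeral_3_eq_3 less_Suc_eq d1 d2)
qed

theorem proposition5p1:
  fixes T v0 x0 :: real
    and b \<sigma> :: "real \<Rightarrow> real \<Rightarrow> real \<Rightarrow> real"
    and \<mu> \<rho> u0 u1 h A B :: "real \<Rightarrow> real \<Rightarrow> real"
  assumes T_pos: "0 < T"
    and rho_nonzero: "\<And>t x. t \<in> {0..T} \<Longrightarrow> \<rho> t x \<noteq> 0"
    \<comment> \<open>Satisfied in particular when \<open>u0\<close>, \<open>u1\<close> and \<open>\<rho>\<close> are \<open>C\<^sup>1\<close>; it is what makes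
      \<open>A\<close> and \<open>B\<close> of class \<open>C\<^sup>1\<close> in time and \<open>C\<^sup>2\<close> in space.\<close>
    and u0_smooth: "C1_fun T (\<lambda>t x. u0 t x / \<rho> t x)"
    and u1_smooth: "C1_fun T (\<lambda>t x. u1 t x / \<rho> t x)"
    and h_smooth: "C12_fun T h"
    and A_eq: "A = (\<lambda>t x. LBINT y=0..x. u0 t y / \<rho> t y)"
    and B_eq: "B = (\<lambda>t x. LBINT y=0..x. u1 t y / \<rho> t y)"
    and normalization: "h 0 v0 + A 0 x0 + B 0 x0 * v0 = 0"
  shows "((\<exists>\<phi> :: real \<Rightarrow> real \<Rightarrow> real \<Rightarrow> real.
             (\<forall>t\<in>{0..<T}. \<forall>v x. \<phi> t v x > 0) \<and>
             (\<forall>t\<in>{0..<T}. \<forall>v. h t v = ln (\<phi> t v 0)) \<and>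
             classical_solution T b \<sigma> \<mu> \<rho> \<phi> \<and>
             \<phi> 0 v0 x0 = 1 \<and>
             (\<forall>t\<in>{0..<T}. \<forall>v x.
                \<rho> t x * deriv (\<lambda>y. ln (\<phi> t v y)) x = u0 t x + u1 t x * v))
          \<longleftrightarrow> compatibility T b \<sigma> \<mu> \<rho> h A B)
       \<and> (compatibility T b \<sigma> \<mu> \<rho> h A B \<longrightarrow>
            (\<forall>t\<in>{0..<T}. \<forall>v x.
               (\<forall>k<3. (deriv ^^ k) (\<lambda>w. G T b \<sigma> h B t w x) differentiable (at v)) \<and>
               (deriv ^^ 3) (\<lambda>w. G T b \<sigma> h B t w x) v = 0))"
proof -
  let ?I = "{0..<T}"
  define \<Phi> where "\<Phi> = (\<lambda>t v x. exp (h t v + A t x + B t x * v))"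
  note A = C12_fun_primitive[OF u0_smooth A_eq] and B = C12_fun_primitive[OF u1_smooth B_eq]
  have solution_iff: "classical_solution T b \<sigma> \<mu> \<rho> \<Phi> \<longleftrightarrow> compatibility T b \<sigma> \<mu> \<rho> h A B"
    by (rule classical_solution_exp_affine_iff[OF h_smooth A(1) B(1) \<Phi>_def])
  have zero: "A t 0 = 0" "B t 0 = 0" for t
    by (simp_all add: A_eq B_eq zero_ereal_def[symmetric])
  have rho: "\<rho> t x \<noteq> 0" if "t \<in> ?I" for t x
    using rho_nonzero that by simp
  have DP: "((\<lambda>y. A t y + B t y * v) has_real_derivative (u0 t x + u1 t x * v) / \<rho> t x) (at x)"
    if "t \<in> ?I" for t v x
  proof -
    have "A t differentiable (at x)" "B t differentiable (at x)"
      using A(1) B(1) that by (auto simp: C12_fun_def C1_fun_def)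
    then have "(A t has_real_derivative u0 t x / \<rho> t x) (at x)"
      "(B t has_real_derivative u1 t x / \<rho> t x) (at x)"
      using deriv_works A(2)[OF that] B(2)[OF that] by metis+
    then show ?thesis
      by (auto intro!: derivative_eq_intros simp: add_divide_distrib)
  qed
  have "compatibility T b \<sigma> \<mu> \<rho> h A B"
    if pos: "\<forall>t\<in>?I. \<forall>v x. \<phi> t v x > 0"
      and at_0: "\<forall>t\<in>?I. \<forall>v. h t v = ln (\<phi> t v 0)"
      and sol: "classical_solution T b \<sigma> \<mu> \<rho> \<phi>"
      and affine: "\<forall>t\<in>?I. \<forall>v x. \<rho> t x * deriv (\<lambda>y. ln (\<phi> t v y)) x = u0 t x + u1 t x * v"
    for \<phi> :: "real \<Rightarrow> real \<Rightarrow> real \<Rightarrow> real"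
  proof -
    have "\<phi> t v x = \<Phi> t v x" if t: "t \<in> ?I" for t v x
    proof -
      have "\<phi> t v x = exp (ln (\<phi> t v 0) + (A t x + B t x * v))"
      proof (rule eq_exp_of_log_derivative)
        show "\<phi> t v differentiable (at x)" for x
          using sol t by (auto simp: classical_solution_def)
        have "deriv (\<lambda>y. ln (\<phi> t v y)) x = (u0 t x + u1 t x * v) / \<rho> t x" for x
          using affine t rho[OF t] by (simp add: eq_divide_eq mult.commute)
        then show "((\<lambda>y. A t y + B t y * v) has_real_derivative deriv (\<lambda>y. ln (\<phi> t v y)) x) (at x)"
          for x using DP[OF t] by simp
      qed (use pos t zero in auto)
      then show ?thesis using at_0 t by (simp add: \<Phi>_def add.assoc)
    qed
    then show ?thesis
      using classical_solution_cong[OF _ sol] solution_iff by blast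
  qed
  moreover have "(\<forall>t\<in>?I. \<forall>v x. \<Phi> t v x > 0) \<and> (\<forall>t\<in>?I. \<forall>v. h t v = ln (\<Phi> t v 0)) \<and>
      classical_solution T b \<sigma> \<mu> \<rho> \<Phi> \<and> \<Phi> 0 v0 x0 = 1 \<and>
      (\<forall>t\<in>?I. \<forall>v x. \<rho> t x * deriv (\<lambda>y. ln (\<Phi> t v y)) x = u0 t x + u1 t x * v)"
    if "compatibility T b \<sigma> \<mu> \<rho> h A B"
  proof (intro conjI ballI allI)
    fix t v x assume t: "t \<in> ?I"
    have "((\<lambda>y. ln (\<Phi> t v y)) has_real_derivative (u0 t x + u1 t x * v) / \<rho> t x) (at x)"
      using DERIV_add[OF DERIV_const DP[OF t], of "h t v"] by (simp add: \<Phi>_def add.assoc)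
    then show "\<rho> t x * deriv (\<lambda>y. ln (\<Phi> t v y)) x = u0 t x + u1 t x * v"
      using rho[OF t] by (simp add: DERIV_imp_deriv)
  qed (use that solution_iff normalization zero in \<open>simp_all add: \<Phi>_def\<close>)
  moreover have "(\<forall>k<3. (deriv ^^ k) (\<lambda>w. G T b \<sigma> h B t w x) differentiable (at v)) \<and>
      (deriv ^^ 3) (\<lambda>w. G T b \<sigma> h B t w x) v = 0"
    if compat: "compatibility T b \<sigma> \<mu> \<rho> h A B" and t: "t \<in> ?I" for t v x
  proof (rule quadratic_third_derivative)
    fix w
    have "I2 \<rho> B t x * w\<^sup>2 + I1 T \<mu> \<rho> A B t x * w + I0 T \<mu> \<rho> A t x + G T b \<sigma> h B t w x = 0"
      using compat t unfolding compatibility_def by blast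
    then show "G T b \<sigma> h B t w x =
        - I2 \<rho> B t x * w\<^sup>2 + - I1 T \<mu> \<rho> A B t x * w + - I0 T \<mu> \<rho> A t x"
      by simp
  qed
  ultimately show ?thesis by blast
qed

end
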